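(* Let $N\geq 2$ be an integer, let $x_1,\ldots,x_N$ be distinct real numbers, and let $D\geq 1$ be an integer. Let $A_{N,D}(x)=\bigl((x_j-x_i)^D\bigr)_{i,j=1}^{N}$. Then $$\det A_{N,D}(x)\neq 0\quad\Longleftrightarrow\quad D\geq N-1\ \text{ and }\ (N\text{ is even or }D\text{ is even}).$$
   Context: $A_{N,D}(x)$ is the real $N\times N$ matrix whose $(i,j)$ entry is $(x_j-x_i)^D$ (in particular its diagonal entries are $0$). *)

theory Defs
  imports Complex_Main "Jordan_Normal_Form.Determinant"
begin

text \<open>
  Library matrices are indexed from 0, so the points \<open>x\<^sub>1, \<dots>, x\<^sub>N\<close> are \<open>x 0, \<dots>, x (N - 1)\<close>;
  values of \<open>x\<close> outside \<open>{..<N}\<close> are irrelevant.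
\<close>

definition diff_power_mat :: "nat \<Rightarrow> nat \<Rightarrow> (nat \<Rightarrow> real) \<Rightarrow> real mat" where
  "diff_power_mat N D x = mat N N (\<lambda>(i, j). (x j - x i) ^ D)"

end

theory Submission imports Defs begin

text \<open>
If \<open>D < N - 1\<close>, the binomial theorem bounds the rank of the matrix by \<open>D + 1 < N\<close>; if \<open>N\<close> and \<open>D\<close> are
odd, the matrix is skew-symmetric of odd size. In both cases the determinant vanishes.

For the converse, a kernel vector \<open>c\<close> gives the polynomial \<open>p(t) = \<Sum> c\<^sub>j (t - x\<^sub>j)\<^sup>D\<close>, which vanishes at
all its nodes \<open>x\<^sub>i\<close>. View \<open>p\<close> as a binary form of degree \<open>D\<close>, with roots on the projective line. The main
tool is a bound on such sums (\<open>power_sum_real_roots\<close>): with \<open>N \<ge> 2\<close> nonzero coefficients and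
\<open>D \<ge> N - 1\<close> there are at most \<open>N\<close> real roots, counted with multiplicity, and in the case of \<open>N\<close> roots
the coefficients alternate in sign around the projective line. It follows by induction on \<open>N\<close>: Laguerre's
polar derivative \<open>D p - (t - x\<^sub>k) p'\<close> removes the \<open>k\<close>-th power, and it loses at most one real root
(\<open>nonreal_count_polar\<close>), since it becomes the ordinary derivative when \<open>x\<^sub>k\<close> is moved to infinity.

Here \<open>p\<close> has the \<open>N\<close> roots \<open>x\<^sub>i\<close>, so equality holds: the \<open>x\<^sub>i\<close> are simple, there are no other
real roots, and the \<open>c\<^sub>j\<close> alternate. A form of degree \<open>D\<close> picks up the sign \<open>(-1)\<^sup>D\<close> at infinity, so
alternation around the whole line forces \<open>N\<close> and \<open>D\<close> to have the same parity. The only case that is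
left under the parity hypothesis is that both are even. There \<open>p'(x\<^sub>i)\<close> alternates as well, so all
products \<open>c\<^sub>i p'(x\<^sub>i)\<close> are nonzero and of the same sign. However, their sum
\<open>\<Sum>\<^sub>i \<Sum>\<^sub>j D c\<^sub>i c\<^sub>j (x\<^sub>i - x\<^sub>j)\<^bsup>D-1\<^esup>\<close> is zero, because the summand is antisymmetric in \<open>i\<close> and \<open>j\<close>
(\<open>power_sum_vanishing_on_nodes\<close>).
\<close>

section \<open>Counting non-real roots\<close>

text \<open>
The number of non-real complex roots with multiplicity. It is measured inside the reals because that
is all the argument needs. For a polynomial \<open>p \<noteq> 0\<close> of degree at most \<open>D\<close>, regarded as a binary form
of degree \<open>D\<close>, the number of real projective roots is \<open>D - nonreal_count p\<close>: a drop of the degree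
below \<open>D\<close> is a root at infinity. Bounding \<open>nonreal_count\<close> from below therefore treats infinity like
every other point.
\<close>

definition nonreal_count :: "real poly \<Rightarrow> nat" where
  "nonreal_count p = degree p - size (proots p)"

lemma degree_eq_size_proots_plus_nonreal_count:
  "degree p = size (proots p) + nonreal_count p"
  using size_proots_le[of p] by (simp add: nonreal_count_def)

lemma nonreal_count_mult:
  assumes "p \<noteq> 0" "q \<noteq> 0"
  shows "nonreal_count (p * q) = nonreal_count p + nonreal_count q"
  using size_proots_le[of p] size_proots_le[of q] assms
  by (simp add: nonreal_count_def proots_mult degree_mult_eq)

lemma nonreal_count_linear: "nonreal_count [:-a, 1:] = 0"
  by (simp add: nonreal_count_def)

lemma nonreal_count_linear_mult: "p \<noteq> 0 \<Longrightarrow> nonreal_count ([:-a, 1:] * p) = nonreal_count p"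
  using nonreal_count_mult[of "[:-a, 1:]" p] by (simp add: nonreal_count_linear del: mult_pCons_left)

lemma nonreal_count_rootfree:
  assumes "\<And>x. poly p x \<noteq> 0"
  shows "nonreal_count p = degree p"
proof -
  have "p \<noteq> 0" using assms by auto
  then have "set_mset (proots p) = {}" using assms by simp
  then show ?thesis by (simp add: nonreal_count_def)
qed

lemma nonreal_count_monom: "nonreal_count (monom 1 n) = 0"
  by (simp add: nonreal_count_def monom_altdef proots_power degree_power_eq
      proots_linear_factor[of 0, simplified])

text \<open>
Splitting off roots one at a time. Invariance of \<open>nonreal_count\<close> under a substitution then has to be
verified only for root-free polynomials, where it is an equality of degrees, and for linear factors.
\<close>

lemma real_root_induct [consumes 1, case_names rootfree factor]:
  fixes p :: "'a::idom poly"
  assumes "p \<noteq> 0"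
    and "\<And>p. (\<And>x. poly p x \<noteq> 0) \<Longrightarrow> P p"
    and "\<And>a p. p \<noteq> 0 \<Longrightarrow> P p \<Longrightarrow> P ([:-a, 1:] * p)"
  shows "P p"
  using assms(1)
proof (induction "degree p" arbitrary: p rule: less_induct)
  case less
  show ?case
  proof (cases "\<exists>a. poly p a = 0")
    case False
    then show ?thesis using assms(2) by blast
  next
    case True
    then obtain a q where q: "p = [:-a, 1:] * q"
      by (metis poly_eq_0_iff_dvd dvdE)
    with less.prems have "q \<noteq> 0" by auto
    then have "degree q < degree p" unfolding q by (subst degree_mult_eq) auto
    then show ?thesis using less.hyps \<open>q \<noteq> 0\<close> assms(3) q by blast
  qed
qed

lemma nonreal_count_translate:
  assumes "p \<noteq> 0"
  shows "nonreal_count (pcompose p [:x, 1:]) = nonreal_count p"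
  using assms
proof (induction p rule: real_root_induct)
  case (rootfree p)
  then show ?case by (simp add: nonreal_count_rootfree poly_pcompose degree_pcompose)
next
  case (factor a p)
  have "pcompose ([:-a, 1:] * p) [:x, 1:] = [:-(a - x), 1:] * pcompose p [:x, 1:]"
    by (simp add: pcompose_mult pcompose_pCons del: mult_pCons_left)
  moreover have "pcompose p [:x, 1:] \<noteq> 0"
    using factor by (simp add: pcompose_eq_0_iff)
  ultimately show ?case using factor nonreal_count_linear_mult by metis
qed

lemma nonreal_count_reflect:
  assumes "p \<noteq> 0"
  shows "nonreal_count (reflect_poly p) = nonreal_count p"
  using assms
proof (induction p rule: real_root_induct)
  case (rootfree p)
  have "poly (reflect_poly p) u \<noteq> 0" for u
  proof (cases "u = 0")
    case True
    then show ?thesis using rootfree by auto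
  next
    case False
    then show ?thesis using rootfree by (simp add: poly_reflect_poly_nz)
  qed
  moreover have "coeff p 0 \<noteq> 0" using rootfree by (metis poly_0_coeff_0)
  ultimately show ?case using rootfree by (simp add: nonreal_count_rootfree)
next
  case (factor a p)
  have "nonreal_count (reflect_poly [:-a, 1:]) = 0"
  proof (cases "a = 0")
    case True
    then show ?thesis by (simp add: nonreal_count_def reflect_poly_def)
  next
    case False
    then have "reflect_poly [:-a, 1:] = smult (-a) [:-(1/a), 1:]"
      by (simp add: reflect_poly_def)
    then show ?thesis using False nonreal_count_linear[of "1/a"] 
      by (simp add: nonreal_count_def del: smult_pCons)
  qed
  then show ?case 
    using factor by (simp add: reflect_poly_mult nonreal_count_mult nonreal_count_linear del: mult_pCons_left)
qed

lemma poly_eqI_nonzero: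
  fixes p q :: "'a::{idom,ring_char_0} poly"
  assumes "\<And>u. u \<noteq> 0 \<Longrightarrow> poly p u = poly q u"
  shows "p = q"
proof -
  have "poly ([:0, 1:] * p) u = poly ([:0, 1:] * q) u" for u
    using assms[of u] by (cases "u = 0") auto
  then have "[:0, 1:] * p = [:0, 1:] * q" using poly_eq_poly_eq_iff by blast
  then show ?thesis by simp
qed

section \<open>Projective coordinate changes\<close>

text \<open>
The projective coordinate change \<open>t = x + 1 / u\<close> for forms of degree \<open>D\<close>, which moves \<open>x\<close> to infinity;
explicitly it is \<open>u\<^sup>D p(x + 1 / u)\<close>. The power of the variable supplies the roots at \<open>u = 0\<close>
that come from roots of the form \<open>p\<close> at infinity.
\<close>

definition invert_at :: "real \<Rightarrow> nat \<Rightarrow> real poly \<Rightarrow> real poly" where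
  "invert_at x D p = monom 1 (D - degree p) * reflect_poly (pcompose p [:x, 1:])"

lemma poly_invert_at:
  assumes "degree p \<le> D" "u \<noteq> 0"
  shows "poly (invert_at x D p) u = u ^ D * poly p (x + 1 / u)"
  using assms
  by (simp add: invert_at_def poly_monom poly_reflect_poly_nz poly_pcompose degree_pcompose
      inverse_eq_divide flip: mult.assoc power_add)

lemma invert_at_unique:
  assumes "degree p \<le> D" "\<And>u. u \<noteq> 0 \<Longrightarrow> poly q u = u ^ D * poly p (x + 1 / u)"
  shows "q = invert_at x D p"
  using assms by (intro poly_eqI_nonzero) (simp add: poly_invert_at)

lemma nonreal_count_invert_at:
  assumes "p \<noteq> 0"
  shows "nonreal_count (invert_at x D p) = nonreal_count p"
  using assms by (simp add: invert_at_def nonreal_count_mult nonreal_count_monom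
      nonreal_count_reflect nonreal_count_translate pcompose_eq_0_iff)

section \<open>Rolle's theorem and Laguerre's theorem\<close>

text \<open>
One new root of the derivative lies between each root and the next. The clause \<open>t < s\<close> is there for the
induction: it keeps the earlier roots of the derivative below the largest element of \<open>S\<close>, so that the
next one is new.
\<close>

lemma Rolle_roots:
  fixes q :: "real poly"
  assumes "finite S" "\<And>x. x \<in> S \<Longrightarrow> poly q x = 0"
  shows "\<exists>T. finite T \<and> T \<inter> S = {} \<and> (\<forall>t\<in>T. poly (pderiv q) t = 0 \<and> (\<exists>s\<in>S. t < s))
    \<and> card S \<le> Suc (card T)"
  using assms
proof (induction S rule: finite_linorder_max_induct)
  case empty
  then show ?case by (intro exI[of _ "{}"]) auto
next
  case (insert b S)
  show ?case
  proof (cases "S = {}")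
    case True
    then show ?thesis by (intro exI[of _ "{}"]) auto
  next
    case False
    obtain T where T: "finite T" "T \<inter> S = {}" "\<forall>t\<in>T. poly (pderiv q) t = 0 \<and> (\<exists>s\<in>S. t < s)"
      "card S \<le> Suc (card T)" using insert by auto
    define a where "a = Max S"
    have a: "a \<in> S" "\<And>s. s \<in> S \<Longrightarrow> s \<le> a" using False insert.hyps by (auto simp: a_def)
    then have "a < b" using insert.hyps by auto
    then obtain t where t: "a < t" "t < b" "poly q b - poly q a = (b - a) * poly (pderiv q) t"
      using poly_MVT by blast
    then have t0: "poly (pderiv q) t = 0" using insert.prems a \<open>a < b\<close> by auto
    have "t \<notin> T" using T a t by force
    moreover have "b \<notin> T" using T insert.hyps by force
    moreover have "t \<notin> S" using a t by force
    ultimately show ?thesis using T t t0 insert.hyps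
      by (intro exI[of _ "insert t T"]) auto
  qed
qed

text \<open>
A root of multiplicity \<open>m\<close> stays a root of the derivative with multiplicity \<open>m - 1\<close>, which loses one
root for each distinct root; Rolle's theorem gives back all of these but one.
\<close>

lemma size_proots_le_pderiv:
  fixes q :: "real poly"
  assumes "pderiv q \<noteq> 0"
  shows "size (proots q) \<le> Suc (size (proots (pderiv q)))"
proof -
  have q: "q \<noteq> 0" using assms by auto
  define S where "S = {x. poly q x = 0}"
  have fS: "finite S" using q by (simp add: S_def poly_roots_finite)
  obtain T where T: "finite T" "T \<inter> S = {}" "\<forall>t\<in>T. poly (pderiv q) t = 0" "card S \<le> Suc (card T)"
    using Rolle_roots[OF fS, of q] by (auto simp: S_def)
  have sub: "mset_set S \<subseteq># proots q"
    using q fS by (auto simp: subseteq_mset_def count_mset_set' S_def order_gt_0_iff Suc_le_eq)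
  have "proots q - mset_set S + mset_set T \<subseteq># proots (pderiv q)"
  proof (rule mset_subset_eqI)
    fix a
    show "count (proots q - mset_set S + mset_set T) a \<le> count (proots (pderiv q)) a"
    proof (cases "a \<in> S")
      case True
      then have "order a q = Suc (order a (pderiv q))"
        using q by (intro order_pderiv) (auto simp: S_def)
      moreover have "a \<notin> T" using True T by auto
      ultimately show ?thesis using True q assms T fS by (simp add: count_mset_set')
    next
      case False
      then have "order a q = 0" by (simp add: S_def order_0I)
      then show ?thesis using T q assms fS by (auto simp: count_mset_set' Suc_le_eq order_gt_0_iff)
    qed
  qed
  then have "size (proots q - mset_set S + mset_set T) \<le> size (proots (pderiv q))"
    by (rule size_mset_mono)
  moreover have "size (proots q) = size (proots q - mset_set S) + card S"
    using sub by (metis size_mset_set size_union subset_mset.diff_add)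
  ultimately show ?thesis using T by simp
qed

lemma nonreal_count_pderiv:
  assumes "pderiv q \<noteq> 0"
  shows "nonreal_count (pderiv q) \<le> nonreal_count q"
  using size_proots_le_pderiv[OF assms] by (simp add: nonreal_count_def degree_pderiv)

text \<open>
Laguerre's polar derivative of a form of degree \<open>D\<close> with respect to the point \<open>x\<close>. It is a form of
degree \<open>D - 1\<close>, and it is ordinary differentiation once \<open>x\<close> has been moved to infinity
(\<open>pderiv_invert_at\<close>).
\<close>

definition polar :: "real \<Rightarrow> nat \<Rightarrow> real poly \<Rightarrow> real poly" where
  "polar x D p = smult (real D) p - [:-x, 1:] * pderiv p"

lemma degree_polar_le:
  assumes "degree p \<le> D" "D > 0"
  shows "degree (polar x D p) \<le> D - 1"
proof -
  have "coeff (polar x D p) i = 0" if "i \<ge> D" for i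
  proof (cases "i = D")
    case True
    \<comment> \<open>The two leading coefficients cancel because \<open>D\<close> is the formal degree.\<close>
    have "coeff p (Suc D) = 0" using assms(1) by (simp add: coeff_eq_0)
    then show ?thesis using True assms(2)
      by (cases D) (simp_all add: polar_def coeff_pderiv algebra_simps)
  next
    case False
    then have "coeff p i = 0" "coeff p (Suc i) = 0" using assms(1) that by (simp_all add: coeff_eq_0)
    then show ?thesis using False that assms(2)
      by (cases i) (simp_all add: polar_def coeff_pderiv)
  qed
  then show ?thesis using assms(2) by (intro degree_le) auto
qed

lemma pderiv_invert_at:
  assumes "degree p \<le> D" "D > 0"
  shows "pderiv (invert_at x D p) = invert_at x (D - 1) (polar x D p)"
proof (rule invert_at_unique)
  fix u :: real
  assume u: "u \<noteq> 0"
  let ?q = "invert_at x D p"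
  have "((\<lambda>u. u ^ D * poly p (x + 1 / u)) has_field_derivative
      (real D * u ^ (D - 1) * poly p (x + 1 / u) 
        + u ^ D * (poly (pderiv p) (x + 1 / u) * (- 1 / (u * u))))) (at u)"
    using u by (auto intro!: derivative_eq_intros DERIV_chain2[OF poly_DERIV])
  moreover have "((\<lambda>u. u ^ D * poly p (x + 1 / u)) has_field_derivative poly (pderiv ?q) u) (at u)"
    using poly_DERIV[of ?q u]
    by (rule has_field_derivative_transform_within_open[of _ _ _ "-{0}"])
      (use u assms(1) in \<open>auto simp: poly_invert_at\<close>)
  ultimately have "poly (pderiv ?q) u = real D * u ^ (D - 1) * poly p (x + 1 / u) 
        + u ^ D * (poly (pderiv p) (x + 1 / u) * (- 1 / (u * u)))"
    by (rule DERIV_unique[rotated])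
  also have "u ^ D = u ^ (D - 1) * u" using assms(2) by (cases D) auto
  finally show "poly (pderiv ?q) u = u ^ (D - 1) * poly (polar x D p) (x + 1 / u)"
    using u by (simp add: polar_def field_simps)
qed (rule degree_polar_le[OF assms])

text \<open>
Laguerre's theorem. Rolle's theorem says that differentiation does not increase \<open>nonreal_count\<close>, and
the coordinate change that turns the polar derivative into differentiation preserves it.
\<close>

lemma nonreal_count_polar:
  assumes "degree p \<le> D" "polar x D p \<noteq> 0"
  shows "nonreal_count (polar x D p) \<le> nonreal_count p"
proof -
  have p: "p \<noteq> 0" using assms(2) by (auto simp: polar_def)
  have D: "D > 0"
  proof (rule ccontr)
    assume "\<not> D > 0"
    then have "pderiv p = 0" "D = 0" using assms(1) by (auto simp: pderiv_eq_0_iff)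
    then show False using assms(2) by (simp add: polar_def)
  qed
  have "pderiv (invert_at x D p) \<noteq> 0"
    unfolding pderiv_invert_at[OF assms(1) D] using assms(2)
    by (simp add: invert_at_def pcompose_eq_0_iff)
  then have "nonreal_count (pderiv (invert_at x D p)) \<le> nonreal_count (invert_at x D p)"
    by (rule nonreal_count_pderiv)
  then show ?thesis
    using p assms(2) by (simp add: pderiv_invert_at[OF assms(1) D] nonreal_count_invert_at)
qed

section \<open>Real roots of sums of powers of linear forms\<close>

definition power_sum :: "real set \<Rightarrow> (real \<Rightarrow> real) \<Rightarrow> nat \<Rightarrow> real poly" where
  "power_sum S c D = (\<Sum>a\<in>S. smult (c a) ([:-a, 1:] ^ D))"

lemma poly_power_sum: "poly (power_sum S c D) t = (\<Sum>a\<in>S. c a * (t - a) ^ D)"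
  by (simp add: power_sum_def poly_sum)

lemma degree_power_sum_le: "degree (power_sum S c D) \<le> D"
proof (cases "finite S")
  case True
  then show ?thesis unfolding power_sum_def
    by (intro degree_sum_le) (simp_all add: degree_linear_power)
qed (simp add: power_sum_def)

lemma poly_pderiv_power_sum:
  "poly (pderiv (power_sum S c D)) t = (\<Sum>a\<in>S. real D * c a * (t - a) ^ (D - 1))"
proof -
  have "pderiv (power_sum S c D) = (\<Sum>a\<in>S. pderiv (smult (c a) ([:-a, 1:] ^ D)))"
    unfolding power_sum_def by (induction S rule: infinite_finite_induct) (simp_all add: pderiv_add)
  also have "poly \<dots> t = (\<Sum>a\<in>S. real D * c a * (t - a) ^ (D - 1))"
    by (simp add: poly_sum pderiv_smult pderiv_power pderiv_pCons algebra_simps)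
  finally show ?thesis .
qed

text \<open>
The polar derivative at the node \<open>k\<close> annihilates \<open>(t - k)\<^sup>D\<close> and maps every other power to a power at the
same node. The new factor \<open>k - a\<close> changes sign exactly when the node passes \<open>k\<close>, which is what makes
sign patterns of the coefficients easy to follow.
\<close>

lemma polar_power_sum:
  assumes "finite S" "D > 0"
  shows "polar k D (power_sum S c D) = power_sum (S - {k}) (\<lambda>a. real D * (k - a) * c a) (D - 1)"
proof (rule poly_ext)
  fix t
  have "(\<Sum>a\<in>S - {k}. real D * (k - a) * c a * (t - a) ^ (D - 1))
      = (\<Sum>a\<in>S. real D * (k - a) * c a * (t - a) ^ (D - 1))"
    using assms by (intro sum.mono_neutral_left) auto
  also have "\<dots> = (\<Sum>a\<in>S. real D * (c a * (t - a) ^ D) - (t - k) * (real D * c a * (t - a) ^ (D - 1)))"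
    using assms(2) by (intro sum.cong) (auto simp: gr0_conv_Suc algebra_simps)
  finally show "poly (polar k D (power_sum S c D)) t
      = poly (power_sum (S - {k}) (\<lambda>a. real D * (k - a) * c a) (D - 1)) t"
    by (simp add: polar_def poly_power_sum poly_pderiv_power_sum sum_subtractf sum_distrib_left
        left_diff_distrib right_diff_distrib)
qed

lemma real_power_roots:
  fixes w :: real
  assumes "w \<noteq> 0" "D > 0"
  shows "card {s. s ^ D = w} \<le> 2" and "card {s. s ^ D = w} = 2 \<Longrightarrow> even D \<and> w > 0"
proof -
  let ?R = "{s. s ^ D = w}"
  have pm: "s = r \<or> s = - r" if "s \<in> ?R" "r \<in> ?R" for r s
  proof -
    have "\<bar>s\<bar> ^ D = \<bar>r\<bar> ^ D" using that by (simp flip: power_abs)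
    then have "\<bar>s\<bar> = \<bar>r\<bar>" using assms(2) by (simp add: power_eq_iff_eq_base)
    then show ?thesis by (auto simp: abs_eq_iff)
  qed
  have sub: "\<exists>r. ?R \<subseteq> {r, - r}"
  proof (cases "?R = {}")
    case False
    then obtain r where "r \<in> ?R" by blast
    then show ?thesis using pm by blast
  qed simp
  then obtain r where "?R \<subseteq> {r, - r}" by blast
  then have "card ?R \<le> card {r, - r}" by (intro card_mono) auto
  also have "\<dots> \<le> 2" by (simp add: card_insert_if)
  finally show "card ?R \<le> 2" .
  assume "card ?R = 2"
  then obtain s r where sr: "s \<noteq> r" "s \<in> ?R" "r \<in> ?R" by (auto simp: card_2_iff)
  then have "s = - r" using pm by blast
  with sr have "(- r) ^ D = r ^ D" "r \<noteq> 0" by auto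
  then have "even D" by (cases "even D") auto
  moreover have "w = r ^ D" using sr by simp
  ultimately show "even D \<and> w > 0" using \<open>r \<noteq> 0\<close> by (simp add: zero_less_power_eq)
qed

text \<open>
Neighbouring coefficients have opposite signs, where the nodes are arranged on the projective line: the
largest node is followed by the smallest one, and passing through infinity multiplies a form of degree
\<open>D\<close> by \<open>(-1)\<^sup>D\<close>.
\<close>

definition cyclically_alternating :: "real set \<Rightarrow> (real \<Rightarrow> real) \<Rightarrow> nat \<Rightarrow> bool" where
  "cyclically_alternating S c D \<longleftrightarrow>
    (\<forall>a\<in>S. \<forall>b\<in>S. a < b \<longrightarrow> (\<forall>s\<in>S. s \<le> a \<or> b \<le> s) \<longrightarrow> c a * c b < 0) \<and>
    (-1) ^ D * c (Min S) * c (Max S) < 0"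

text \<open>
The base case. Moving \<open>a\<close> to infinity turns \<open>p\<close> into \<open>c a + c b (1 - y u)\<^sup>D\<close>, so its real roots
correspond to the real solutions of \<open>s\<^sup>D = - c a / c b\<close>; they are simple, there are at most two, and
two of them require \<open>D\<close> even and \<open>c a\<close>, \<open>c b\<close> of opposite sign.
\<close>

lemma two_powers:
  fixes a b :: real
  assumes "a < b" "c a \<noteq> 0" "c b \<noteq> 0" "D > 0"
  defines "p \<equiv> power_sum {a, b} c D"
  shows "p \<noteq> 0" and "D \<le> nonreal_count p + 2"
    and "D = nonreal_count p + 2 \<Longrightarrow> cyclically_alternating {a, b} c D"
proof -
  define y where "y = b - a"
  have y: "y > 0" using assms(1) by (simp add: y_def)
  define q where "q = [:c a:] + smult (c b) ([:1, -y:] ^ D)"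
  have pv: "poly p t = c a * (t - a) ^ D + c b * (t - b) ^ D" for t
    using assms(1) by (simp add: p_def poly_power_sum)
  have "poly p a \<noteq> 0"
    unfolding pv using assms(1-4) by (simp add: zero_power)
  then show p0: "p \<noteq> 0" by auto
  have "q = invert_at a D p"
  proof (rule invert_at_unique)
    show "degree p \<le> D" unfolding p_def by (rule degree_power_sum_le)
    fix u :: real assume u: "u \<noteq> 0"
    have "poly q u = c a * (u * (1 / u)) ^ D + c b * (u * (a + 1 / u - b)) ^ D"
      using u by (simp add: q_def y_def algebra_simps)
    also have "\<dots> = u ^ D * poly p (a + 1 / u)"
      unfolding pv power_mult_distrib by (simp add: algebra_simps)
    finally show "poly q u = u ^ D * poly p (a + 1 / u)" .
  qed
  then have nr: "nonreal_count p = nonreal_count q"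
    using nonreal_count_invert_at[OF p0] by simp
  have "degree ([:1, -y:] ^ D) = D" using y by (simp add: degree_power_eq)
  then have deg: "degree q = D"
    unfolding q_def using assms(3,4) by (subst degree_add_eq_right) auto
  then have q0: "q \<noteq> 0" using assms(4) by auto
  let ?w = "- c a / c b"
  have root: "poly q u = 0 \<longleftrightarrow> (1 - y * u) ^ D = ?w" for u
    using assms(3) by (auto simp: q_def field_simps add_eq_0_iff)
  have "order u q \<le> 1" for u
  proof (cases "poly q u = 0")
    case True
    have "poly (pderiv q) u = - (real D * y * c b * (1 - y * u) ^ (D - 1))"
      by (simp add: q_def pderiv_add pderiv_smult pderiv_power pderiv_pCons algebra_simps)
    moreover have "(1 - y * u) ^ D \<noteq> 0" using root[of u] True assms(2,3) by simp
    then have "1 - y * u \<noteq> 0" using assms(4) by (metis power_eq_0_iff)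
    ultimately have "poly (pderiv q) u \<noteq> 0" using assms(3,4) y by simp
    then show ?thesis using order_pderiv[OF q0 True] order_0I by fastforce
  next
    case False
    then show ?thesis by (simp add: order_0I)
  qed
  then have "proots q = mset_set {u. poly q u = 0}"
    using q0 poly_roots_finite[OF q0]
    by (intro multiset_eqI) (auto simp: count_mset_set' order_eq_0_iff order_0I le_Suc_eq)
  then have "size (proots q) = card {u. poly q u = 0}" by simp
  also have "\<dots> = card {s. s ^ D = ?w}"
    by (rule bij_betw_same_card[of "\<lambda>u. 1 - y * u"], rule bij_betwI[where g = "\<lambda>s. (1 - s) / y"])
      (use y root in \<open>auto simp: field_simps\<close>)
  finally have size: "size (proots q) = card {s. s ^ D = ?w}" .
  have D: "D = card {s. s ^ D = ?w} + nonreal_count p"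
    using degree_eq_size_proots_plus_nonreal_count[of q] by (simp add: deg nr size)
  have w: "?w \<noteq> 0" using assms(2,3) by simp
  show "D \<le> nonreal_count p + 2" using D real_power_roots(1)[OF w assms(4)] by linarith
  assume "D = nonreal_count p + 2"
  with D have "card {s. s ^ D = ?w} = 2" by linarith
  then have "even D" "?w > 0" using real_power_roots(2)[OF w assms(4)] by auto
  then have "c a * c b < 0" "even D"
    using assms(2,3) by (auto simp: divide_less_0_iff mult_less_0_iff)
  then show "cyclically_alternating {a, b} c D"
    using assms(1) by (auto simp: cyclically_alternating_def)
qed

text \<open>
For \<open>D \<ge> N - 1\<close>, a sum of \<open>N \<ge> 2\<close> powers with nonzero coefficients has at most \<open>N\<close> real projective roots, counted with
multiplicity, and if it has \<open>N\<close> then its coefficients alternate cyclically. This is the extreme case of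
a cyclic Descartes rule of signs. Each polar derivative at a node removes one power and, by Laguerre's
theorem, at most one root. In the case of equality every polar derivative is again extremal, so its
coefficients alternate; two neighbouring nodes are compared by removing some third node, which leaves
them neighbours. A single power has a root of multiplicity \<open>D\<close>, which is why the induction starts at
two.
\<close>

lemma power_sum_real_roots:
  assumes "finite S" "card S \<ge> 2" "card S \<le> D + 1" "\<And>a. a \<in> S \<Longrightarrow> c a \<noteq> 0"
  defines "p \<equiv> power_sum S c D"
  shows "p \<noteq> 0 \<and> D \<le> nonreal_count p + card S
    \<and> (D = nonreal_count p + card S \<longrightarrow> cyclically_alternating S c D)"
  using assms(1-4) unfolding p_def
proof (induction "card S" arbitrary: S c D rule: less_induct)
  case less
  show ?case
  proof (cases "card S = 2")
    case True
    then obtain a b where ab: "S = {a, b}" "a < b"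
      by (metis card_2_iff insert_commute linorder_less_linear)
    then show ?thesis using less.prems two_powers[of a b c D] by simp
  next
    case False
    with less.prems have S3: "card S \<ge> 3" and D: "D > 0" by auto
    let ?p = "power_sum S c D"
    define c' where "c' k a = real D * (k - a) * c a" for k a
    define r where "r k = power_sum (S - {k}) (c' k) (D - 1)" for k
    have r: "r k = polar k D ?p" for k
      using polar_power_sum[OF less.prems(1) D] by (simp add: r_def c'_def[abs_def])
    have IH: "r k \<noteq> 0 \<and> D \<le> nonreal_count (r k) + card S
        \<and> (D = nonreal_count (r k) + card S \<longrightarrow> cyclically_alternating (S - {k}) (c' k) (D - 1))"
      if k: "k \<in> S" for k
    proof -
      have card: "card (S - {k}) = card S - 1" using k less.prems by simp
      have "power_sum (S - {k}) (c' k) (D - 1) \<noteq> 0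
        \<and> D - 1 \<le> nonreal_count (power_sum (S - {k}) (c' k) (D - 1)) + card (S - {k})
        \<and> (D - 1 = nonreal_count (power_sum (S - {k}) (c' k) (D - 1)) + card (S - {k})
          \<longrightarrow> cyclically_alternating (S - {k}) (c' k) (D - 1))"
        by (rule less.hyps) (use less.prems card S3 D in \<open>auto simp: c'_def\<close>)
      then show ?thesis using card S3 D unfolding r_def by auto
    qed
    have nr: "nonreal_count (r k) \<le> nonreal_count ?p" if "k \<in> S" for k
      using IH[OF that] nonreal_count_polar[OF degree_power_sum_le, of k D S c] by (simp add: r)
    obtain k where k: "k \<in> S" using S3 by fastforce
    have "?p \<noteq> 0" using IH[OF k] by (auto simp: r polar_def)
    moreover have "D \<le> nonreal_count ?p + card S" using IH[OF k] nr[OF k] by linarith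
    moreover have "cyclically_alternating S c D" if eq: "D = nonreal_count ?p + card S"
    proof -
      have signs: "cyclically_alternating (S - {k}) (c' k) (D - 1)" if "k \<in> S" for k
      proof -
        have "D = nonreal_count (r k) + card S" using IH[OF that] nr[OF that] eq by linarith
        then show ?thesis using IH[OF that] by blast
      qed
      have third: "\<exists>k\<in>S. k \<noteq> a \<and> k \<noteq> b" for a b
      proof (rule ccontr)
        assume "\<not> ?thesis"
        then have "S \<subseteq> {a, b}" by auto
        then have "card S \<le> card {a, b}" by (intro card_mono) auto
        also have "\<dots> \<le> 2" by (simp add: card_insert_if)
        finally show False using S3 by simp
      qed
      have "c a * c b < 0" if ab: "a \<in> S" "b \<in> S" "a < b" "\<forall>s\<in>S. s \<le> a \<or> b \<le> s" for a b
      proof -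
        \<comment> \<open>The node \<open>k\<close> lies on one side of both \<open>a\<close> and \<open>b\<close>, so the product of the signs is unchanged.\<close>
        obtain k where k: "k \<in> S" "k \<noteq> a" "k \<noteq> b" using third by blast
        have "c' k a * c' k b < 0"
          using signs[OF k(1)] ab k unfolding cyclically_alternating_def by blast
        moreover have "c' k a * c' k b = (real D)\<^sup>2 * ((k - a) * (k - b)) * (c a * c b)"
          by (simp add: c'_def power2_eq_square)
        moreover have "(k - a) * (k - b) > 0"
          using ab k by (force simp: zero_less_mult_iff)
        then have "(real D)\<^sup>2 * ((k - a) * (k - b)) > 0" using D by simp
        ultimately show ?thesis by (metis less_asym mult_less_0_iff)
      qed
      moreover have "(-1) ^ D * c (Min S) * c (Max S) < 0"
      proof -
        \<comment> \<open>Here \<open>k\<close> lies between the two nodes, so the product of the coefficients changes sign;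
          the change of \<open>D\<close> to \<open>D - 1\<close> compensates for it.\<close>
        obtain k where k: "k \<in> S" "k \<noteq> Min S" "k \<noteq> Max S" using third by blast
        have "S \<noteq> {}" using k by auto
        then have ends: "Min S \<in> S" "Max S \<in> S" using less.prems(1) by simp_all
        have "Min S < k" "k < Max S" using k less.prems(1) by (auto simp: less_le)
        have "Min (S - {k}) = Min S" "Max (S - {k}) = Max S"
          using less.prems(1) k ends by (auto intro!: Min_eqI Max_eqI)
        then have "(-1) ^ (D - 1) * c' k (Min S) * c' k (Max S) < 0"
          using signs[OF k(1)] by (simp add: cyclically_alternating_def)
        moreover have "(-1) ^ (D - 1) * c' k (Min S) * c' k (Max S)
          = ((real D)\<^sup>2 * ((k - Min S) * (Max S - k))) * ((-1) ^ D * c (Min S) * c (Max S))"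
          using D by (cases D) (simp_all add: c'_def power2_eq_square algebra_simps)
        moreover have "(real D)\<^sup>2 * ((k - Min S) * (Max S - k)) > 0"
          using \<open>Min S < k\<close> \<open>k < Max S\<close> D by simp
        ultimately show ?thesis by (metis less_asym mult_less_0_iff)
      qed
      ultimately show ?thesis by (auto simp: cyclically_alternating_def)
    qed
    ultimately show ?thesis by blast
  qed
qed

section \<open>Sums of powers that vanish at their nodes\<close>

lemma sign_constant_of_adjacent:
  fixes S :: "'a::linorder set" and f :: "'a \<Rightarrow> real"
  assumes "finite S" "\<And>a. a \<in> S \<Longrightarrow> f a \<noteq> 0"
    and "\<And>a b. a \<in> S \<Longrightarrow> b \<in> S \<Longrightarrow> a < b \<Longrightarrow> (\<forall>s\<in>S. s \<le> a \<or> b \<le> s) \<Longrightarrow> f a * f b > 0"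
    and "a \<in> S" "b \<in> S"
  shows "f a * f b > 0"
proof -
  have "\<forall>a\<in>S. \<forall>b\<in>S. f a * f b > 0"
    using assms(1-3)
  proof (induction S rule: finite_linorder_max_induct)
    case empty
    then show ?case by simp
  next
    case (insert m S)
    have IH: "\<forall>a\<in>S. \<forall>b\<in>S. f a * f b > 0"
    proof (rule insert.IH)
      fix a b assume "a \<in> S" "b \<in> S" "a < b" "\<forall>s\<in>S. s \<le> a \<or> b \<le> s"
      then show "f a * f b > 0" using insert.hyps(2) by (intro insert.prems(2)) auto
    qed (use insert.prems(1) in blast)
    have m: "f a * f m > 0" if a: "a \<in> S" for a
    proof -
      let ?b = "Max S"
      have b: "?b \<in> S" "\<forall>s\<in>S. s \<le> ?b" using a insert.hyps by (auto intro: Max_in)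
      then have "f ?b * f m > 0" using insert.hyps by (intro insert.prems) auto
      moreover have "f a * f ?b > 0" using IH a b by blast
      ultimately show ?thesis by (auto simp: zero_less_mult_iff)
    qed
    have "f m * f m > 0" using insert.prems(1)[of m] by (auto simp: zero_less_mult_iff)
    then show ?case using IH m by (auto simp: mult.commute)
  qed
  then show ?thesis using assms by blast
qed

text \<open>
A full turn around the projective line makes \<open>card S\<close> sign changes and must reproduce the first
coefficient times \<open>(-1)\<^sup>D\<close>.
\<close>

lemma cyclically_alternating_parity:
  assumes "cyclically_alternating S c D" "finite S" "S \<noteq> {}" "\<And>a. a \<in> S \<Longrightarrow> c a \<noteq> 0"
  shows "even (card S + D)"
proof -
  let ?rank = "\<lambda>a. card {s\<in>S. s < a}"
  let ?f = "\<lambda>a. (-1) ^ ?rank a * c a"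
  \<comment> \<open>Twisting by the parity of the position makes an alternating sequence constant in sign.\<close>
  have "?f (Min S) * ?f (Max S) > 0"
  proof (rule sign_constant_of_adjacent[where f = ?f, OF assms(2)])
    fix a b assume ab: "a \<in> S" "b \<in> S" "a < b" "\<forall>s\<in>S. s \<le> a \<or> b \<le> s"
    then have "{s\<in>S. s < b} = insert a {s\<in>S. s < a}" by force
    then have "?rank b = Suc (?rank a)" using assms(2) by simp
    moreover have "c a * c b < 0" using ab assms(1) unfolding cyclically_alternating_def by blast
    ultimately show "?f a * ?f b > 0"
      by (cases "even (?rank a)") (simp_all add: mult_less_0_iff zero_less_mult_iff)
  qed (use assms in auto)
  moreover have "{s\<in>S. s < Min S} = {}" using assms(2) by (auto simp: not_less)
  then have "?rank (Min S) = 0" by (simp only: card.empty)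
  moreover have "{s\<in>S. s < Max S} = S - {Max S}" using assms(2,3) by (auto simp: less_le)
  then have "?rank (Max S) = card S - 1" using assms(2,3) by simp
  ultimately have "(-1) ^ (card S - 1) * (c (Min S) * c (Max S)) > 0" by (simp add: mult_ac)
  moreover have "(-1) ^ D * (c (Min S) * c (Max S)) < 0"
    using assms(1) by (simp add: cyclically_alternating_def mult_ac)
  ultimately have "even (card S - 1) \<noteq> even D"
    by (cases "even (card S - 1)"; cases "even D") auto
  then show ?thesis using assms(2,3) by (cases "card S") auto
qed

lemma pderiv_signs_at_adjacent_roots:
  fixes p :: "real poly"
  assumes "a < b" "poly p a = 0" "poly p b = 0" "\<And>t. a < t \<Longrightarrow> t < b \<Longrightarrow> poly p t \<noteq> 0"
  shows "poly (pderiv p) a * poly (pderiv p) b \<le> 0"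
proof -
  have no: "\<not> (poly (pderiv p) a > 0 \<and> poly (pderiv p) b > 0)"
    if p: "poly p a = 0" "poly p b = 0" "\<And>t. a < t \<Longrightarrow> t < b \<Longrightarrow> poly p t \<noteq> 0" for p
  proof
    assume pos: "poly (pderiv p) a > 0 \<and> poly (pderiv p) b > 0"
    obtain d where d: "d > 0" "\<And>h. 0 < h \<Longrightarrow> h < d \<Longrightarrow> poly p a < poly p (a + h)"
      using DERIV_pos_inc_right[OF poly_DERIV] pos by blast
    obtain e where e: "e > 0" "\<And>h. 0 < h \<Longrightarrow> h < e \<Longrightarrow> poly p (b - h) < poly p b"
      using DERIV_pos_inc_left[OF poly_DERIV] pos by blast
    define h where "h = min (min d e) (b - a) / 3"
    have h: "0 < h" "h < d" "h < e" "a + h < b - h"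
      using assms(1) d(1) e(1) by (auto simp: h_def min_def field_simps)
    then have "poly p (a + h) > 0" "poly p (b - h) < 0" using d(2)[of h] e(2)[of h] p by auto
    then obtain t where "a + h < t" "t < b - h" "poly p t = 0" using poly_IVT_neg h(4) by blast
    then show False using p(3)[of t] h by auto
  qed
  show ?thesis
    using no[of p] no[of "- p"] assms by (auto simp: pderiv_minus mult_le_0_iff not_less)
qed

lemma sum_antisymmetric:
  fixes f :: "'a \<Rightarrow> 'a \<Rightarrow> real"
  assumes "\<And>a b. f a b = - f b a"
  shows "(\<Sum>a\<in>S. \<Sum>b\<in>S. f a b) = 0"
proof -
  have "(\<Sum>a\<in>S. \<Sum>b\<in>S. f a b) = (\<Sum>b\<in>S. \<Sum>a\<in>S. f a b)" by (rule sum.swap)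
  also have "\<dots> = - (\<Sum>b\<in>S. \<Sum>a\<in>S. f b a)" by (subst assms) (simp add: sum_negf)
  finally show ?thesis by simp
qed

text \<open>
The heart of the theorem. If \<open>p = \<Sum> c\<^sub>a (t - a)\<^sup>D\<close> vanishes at all its nodes and is not trivial, then
the bound on the number of real roots is attained: all coefficients are nonzero, the roots are exactly
the nodes, they are simple, and the coefficients alternate. Going around the projective line shows that
\<open>card S\<close> and \<open>D\<close> have the same parity, hence are both even here. Since \<open>p'\<close> also alternates along the
simple roots of \<open>p\<close>, all the numbers \<open>c\<^sub>x p'(x)\<close> have the same sign. But their sum is the double sum of
\<open>D c\<^sub>x c\<^sub>a (x - a)\<^bsup>D-1\<^esup>\<close>, which is zero because \<open>D - 1\<close> is odd.
\<close>

lemma power_sum_vanishing_on_nodes: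
  fixes S :: "real set"
  assumes "finite S" "card S \<ge> 2" "card S \<le> D + 1" "even (card S) \<or> even D"
    and zero: "\<And>x. x \<in> S \<Longrightarrow> (\<Sum>a\<in>S. c a * (x - a) ^ D) = 0"
    and "a \<in> S"
  shows "c a = 0"
proof (rule ccontr)
  assume "c a \<noteq> 0"
  \<comment> \<open>The root bound needs nonzero coefficients; counting roots will show \<open>J = S\<close>.\<close>
  define J where "J = {a\<in>S. c a \<noteq> 0}"
  define p where "p = power_sum J c D"
  have J: "finite J" "J \<subseteq> S" "a \<in> J" using assms(1,6) \<open>c a \<noteq> 0\<close> by (auto simp: J_def)
  have p_eq: "poly p t = (\<Sum>a\<in>S. c a * (t - a) ^ D)" for t
    unfolding p_def poly_power_sum using assms(1) by (intro sum.mono_neutral_left) (auto simp: J_def)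
  have root: "poly p x = 0" if "x \<in> S" for x using zero[OF that] by (simp add: p_eq)
  have J2: "card J \<ge> 2"
  proof (rule ccontr)
    assume "\<not> card J \<ge> 2"
    moreover have "card J > 0" using J by (auto simp: card_gt_0_iff)
    ultimately have "card J = 1" by linarith
    then have "J = {a}" using J(3) by (auto simp: card_1_singleton_iff)
    then have "poly p t = c a * (t - a) ^ D" for t by (simp add: p_def poly_power_sum)
    moreover have "card (S - {a}) > 0" using assms(1,2,6) by simp
    then obtain x where "x \<in> S" "x \<noteq> a" by (metis card_gt_0_iff Diff_iff ex_in_conv singletonI)
    ultimately show False using root[of x] \<open>c a \<noteq> 0\<close> by simp
  qed
  have JS: "card J \<le> card S" using J assms(1) by (intro card_mono) auto
  have main: "p \<noteq> 0" "D \<le> nonreal_count p + card J"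
    "D = nonreal_count p + card J \<Longrightarrow> cyclically_alternating J c D"
    using power_sum_real_roots[OF J(1) J2, of D c] JS assms(3) unfolding p_def J_def
    by (blast intro: le_trans)+
  have deg: "degree p \<le> D" unfolding p_def by (rule degree_power_sum_le)
  have sub: "mset_set S \<subseteq># proots p"
    using assms(1) main(1) root
    by (auto simp: subseteq_mset_def count_mset_set' Suc_le_eq order_gt_0_iff)
  then have "card S \<le> size (proots p)" using size_mset_mono by fastforce
  then have eqs: "card J = card S" "size (proots p) = card S" "D = nonreal_count p + card J"
    using main(2) JS deg degree_eq_size_proots_plus_nonreal_count[of p] by linarith+
  then have "J = S" using J assms(1) by (intro card_subset_eq) auto
  have "mset_set S = proots p"
    using sub eqs(2) assms(1) by (metis nless_le size_mset_set mset_subset_size subset_mset.nless_le)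
  then have roots: "poly p t = 0 \<longleftrightarrow> t \<in> S" for t
    using assms(1) main(1) by (metis (mono_tags) finite_set_mset_mset_set mem_Collect_eq set_count_proots)
  have signs: "cyclically_alternating S c D" using main(3) eqs \<open>J = S\<close> by blast
  have c0: "c x \<noteq> 0" if "x \<in> S" for x using that \<open>J = S\<close> by (auto simp: J_def)
  have "even (card S + D)" using cyclically_alternating_parity[OF signs assms(1)] c0 assms(6) by auto
  then have "even D" using assms(4) by auto
  then have "odd (D - 1)" using assms(2,3) by (cases D) auto
  have simple: "poly (pderiv p) x \<noteq> 0" if "x \<in> S" for x
  proof -
    have "order x p = 1"
      using \<open>mset_set S = proots p\<close> that assms(1) main(1)
      by (metis count_mset_set(1) count_proots)
    then have "order x (pderiv p) = 0"
      using order_pderiv[OF main(1), of x] root[OF that] by simp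
    moreover have "pderiv p \<noteq> 0" 
    proof
      assume "pderiv p = 0"
      then have "degree p = 0" by (simp add: pderiv_eq_0_iff)
      then show False using eqs(2) assms(2) size_proots_le[of p] by simp
    qed
    ultimately show ?thesis by (simp add: order_eq_0_iff)
  qed
  let ?g = "\<lambda>x. c x * poly (pderiv p) x"
  have same: "?g x * ?g y > 0" if "x \<in> S" "y \<in> S" for x y
  proof (rule sign_constant_of_adjacent[where f = ?g, OF assms(1) _ _ that])
    fix a b assume ab: "a \<in> S" "b \<in> S" "a < b" "\<forall>s\<in>S. s \<le> a \<or> b \<le> s"
    then have "c a * c b < 0" using signs unfolding cyclically_alternating_def by blast
    moreover have "poly (pderiv p) a * poly (pderiv p) b \<le> 0"
      using ab roots by (intro pderiv_signs_at_adjacent_roots) force+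
    then have "poly (pderiv p) a * poly (pderiv p) b < 0"
      using simple ab by (simp add: less_le)
    ultimately show "?g a * ?g b > 0"
      using mult_neg_neg by (fastforce simp: mult_ac)
  qed (use c0 simple in auto)
  have "(\<Sum>x\<in>S. ?g a * ?g x) > 0"
    using assms(1,6) same by (intro sum_pos) auto
  then have "?g a * (\<Sum>x\<in>S. ?g x) > 0" by (simp add: sum_distrib_left)
  moreover have "(\<Sum>x\<in>S. ?g x) = (\<Sum>x\<in>S. \<Sum>b\<in>S. real D * c x * c b * (x - b) ^ (D - 1))"
    by (simp add: p_def \<open>J = S\<close> poly_pderiv_power_sum sum_distrib_left mult_ac)
  moreover have "\<dots> = 0"
  proof (rule sum_antisymmetric)
    fix x b :: real
    have "(x - b) ^ (D - 1) = - ((b - x) ^ (D - 1))"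
      using \<open>odd (D - 1)\<close> by (metis minus_diff_eq power_minus_odd)
    then show "real D * c x * c b * (x - b) ^ (D - 1) = - (real D * c b * c x * (b - x) ^ (D - 1))"
      by simp
  qed
  ultimately show False by simp
qed

section \<open>The determinant\<close>

text \<open>
By the binomial theorem the matrix has rank at most \<open>D + 1\<close>. Filling up the two factors of size
\<open>N \<times> (D + 1)\<close> and \<open>(D + 1) \<times> N\<close> to square matrices makes this visible as a zero column.
\<close>

lemma det_diff_power_mat_rank:
  assumes "D + 1 < N"
  shows "det (diff_power_mat N D x) = 0"
proof -
  define B where "B = mat N N (\<lambda>(i, k). if k \<le> D then of_nat (D choose k) * (- x i) ^ (D - k) else 0)"
  define C where "C = mat N N (\<lambda>(k, j). x j ^ k)"
  have BC: "B \<in> carrier_mat N N" "C \<in> carrier_mat N N" by (auto simp: B_def C_def)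
  have "diff_power_mat N D x = B * C"
  proof (rule eq_matI)
    fix i j assume "i < dim_row (B * C)" "j < dim_col (B * C)"
    then have ij: "i < N" "j < N" using BC by auto
    have "(B * C) $$ (i, j) = (\<Sum>k<N. if k \<le> D then of_nat (D choose k) * (- x i) ^ (D - k) * x j ^ k else 0)"
      using ij by (auto simp: B_def C_def scalar_prod_def lessThan_atLeast0 intro!: sum.cong)
    also have "\<dots> = (\<Sum>k\<le>D. of_nat (D choose k) * (- x i) ^ (D - k) * x j ^ k)"
      using assms by (intro sum.mono_neutral_cong_right) auto
    also have "\<dots> = (x j + - x i) ^ D"
      unfolding binomial_ring by (intro sum.cong) (auto simp: mult_ac)
    finally show "diff_power_mat N D x $$ (i, j) = (B * C) $$ (i, j)"
      using ij by (simp add: diff_power_mat_def)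
  qed (auto simp: diff_power_mat_def B_def C_def)
  moreover have "det B = 0"
  proof -
    \<comment> \<open>Column \<open>D + 1\<close> is the first of the zero columns of \<open>B\<close>.\<close>
    have "unit_vec N (D + 1) \<noteq> (0\<^sub>v N :: real vec)" using assms by auto
    moreover have "B *\<^sub>v unit_vec N (D + 1) = 0\<^sub>v N"
      using assms by (intro eq_vecI) (auto simp: B_def)
    ultimately show ?thesis
      using det_0_iff_vec_prod_zero[OF BC(1)] unit_vec_carrier by blast
  qed
  ultimately show ?thesis using det_mult[OF BC] by simp
qed

text \<open>
A skew-symmetric matrix of odd size is singular.
\<close>

lemma det_diff_power_mat_skew:
  assumes "odd N" "odd D"
  shows "det (diff_power_mat N D x) = 0"
proof -
  let ?A = "diff_power_mat N D x"
  have A: "?A \<in> carrier_mat N N" by (simp add: diff_power_mat_def)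
  have "transpose_mat ?A = (-1) \<cdot>\<^sub>m ?A"
  proof (rule eq_matI)
    fix i j assume ij: "i < dim_row ((-1) \<cdot>\<^sub>m ?A)" "j < dim_col ((-1) \<cdot>\<^sub>m ?A)"
    have "(x i - x j) ^ D = - ((x j - x i) ^ D)"
      using assms(2) by (metis minus_diff_eq power_minus_odd)
    then show "transpose_mat ?A $$ (i, j) = ((-1) \<cdot>\<^sub>m ?A) $$ (i, j)"
      using ij by (simp add: diff_power_mat_def)
  qed (auto simp: diff_power_mat_def)
  then have "det ?A = (-1) ^ N * det ?A"
    using det_transpose[OF A] A by simp
  then show ?thesis using assms(1) by simp
qed

text \<open>
A kernel vector \<open>v\<close> consists of the coefficients of a sum of powers with nodes \<open>x\<^sub>j\<close> that vanishes at
all its nodes. The coefficients are transported to functions on the set of nodes, on which the order of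
the reals replaces the arbitrary order of the indices.
\<close>

lemma det_diff_power_mat_nonzero:
  assumes "N \<ge> 2" "inj_on x {..<N}" "N \<le> D + 1" "even N \<or> even D"
  shows "det (diff_power_mat N D x) \<noteq> 0"
proof
  let ?A = "diff_power_mat N D x"
  have A: "?A \<in> carrier_mat N N" by (simp add: diff_power_mat_def)
  assume "det ?A = 0"
  then obtain v where v: "v \<in> carrier_vec N" "v \<noteq> 0\<^sub>v N" "?A *\<^sub>v v = 0\<^sub>v N"
    using det_0_iff_vec_prod_zero[OF A] by blast
  define S where "S = x ` {..<N}"
  define c where "c a = v $ (the_inv_into {..<N} x a)" for a
  have c: "c (x j) = v $ j" if "j < N" for j
    using assms(2) that by (simp add: c_def the_inv_into_f_f)
  have S: "finite S" "card S = N" using assms(2) by (simp_all add: S_def card_image)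
  have "(\<Sum>a\<in>S. c a * (t - a) ^ D) = 0" if t: "t \<in> S" for t
  proof -
    obtain i where i: "i < N" "t = x i" using t by (auto simp: S_def)
    have "0 = (?A *\<^sub>v v) $ i" using v(3) i by simp
    also have "\<dots> = (\<Sum>j<N. (x j - x i) ^ D * v $ j)"
      using i v(1) by (auto simp: diff_power_mat_def scalar_prod_def lessThan_atLeast0 intro!: sum.cong)
    also have "\<dots> = (-1) ^ D * (\<Sum>j<N. c (x j) * (x i - x j) ^ D)"
      unfolding sum_distrib_left
    proof (intro sum.cong refl)
      fix j assume "j \<in> {..<N}"
      moreover have "(x j - x i) ^ D = (-1) ^ D * (x i - x j) ^ D"
        by (simp flip: power_mult_distrib)
      ultimately show "(x j - x i) ^ D * v $ j = (-1) ^ D * (c (x j) * (x i - x j) ^ D)"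
        using c by simp
    qed
    also have "(\<Sum>j<N. c (x j) * (x i - x j) ^ D) = (\<Sum>a\<in>S. c a * (t - a) ^ D)"
      unfolding S_def i(2) by (simp add: sum.reindex[OF assms(2)])
    finally show ?thesis by simp
  qed
  then have "c a = 0" if "a \<in> S" for a
    using power_sum_vanishing_on_nodes[of S D c a] S assms that by auto
  then have "v $ j = 0" if "j < N" for j using c that by (auto simp: S_def)
  then have "v = 0\<^sub>v N" using v(1) by (intro eq_vecI) auto
  then show False using v(2) by contradiction
qed

theorem theorem1p1:
  fixes N D :: nat and x :: "nat \<Rightarrow> real"
  assumes "N \<ge> 2"
    and "inj_on x {..<N}"
    and "D \<ge> 1"
  shows "det (diff_power_mat N D x) \<noteq> 0 \<longleftrightarrow> D \<ge> N - 1 \<and> (even N \<or> even D)"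
  using det_diff_power_mat_rank[of D N x] det_diff_power_mat_skew[of N D x]
    det_diff_power_mat_nonzero[OF assms(1,2), of D]
  by (cases "D + 1 < N") (auto simp: not_less le_diff_conv)

end
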